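(* Let $\varepsilon\in\{1,-1\}$, $d\in\{0,1,2\}$, and let $s\le 0$ be an even integer. For all positive integers $n,m$ with $-s/2\le m\le n-s$, $$\sum_{k=-n}^m \varepsilon^{k+d}\left(\frac{k+d}{3}\right) q^{\frac{k^2+sk}{2}}\begin{bmatrix} n+m\\ n+k\end{bmatrix} =\frac{(-\varepsilon q^{\frac32};q^3)_{m+s/2}}{(-\varepsilon q^{\frac12};q)_{m+s/2}}\;\mathcal{L}_z\left(q^{-\frac{s^2}{8}}(\varepsilon z)^{d-\frac{s}{2}}\,(-\varepsilon q^{m+\frac{s+1}{2}}/z;q)_{n-m-s}\right).$$
   Context: Here $q$ and $z$ are formal variables, with $q^{1/2}$ a fixed formal square root of $q$. The $q$-shifted factorial is $(a;q)_n=(1-a)(1-aq)\cdots(1-aq^{n-1})$ for $n\ge 1$ and $(a;q)_0=1$; likewise $(a;q^3)_n$ is the same with $q$ replaced by $q^3$. The $q$-binomial coefficient is $\begin{bmatrix} n\\ k\end{bmatrix}=\frac{(q;q)_n}{(q;q)_k(q;q)_{n-k}}$ if $0\le k\le n$, and $0$ otherwise. The Legendre symbol modulo $3$ is $\left(\frac{j}{3}\right)=0,1,-1$ according as $j\equiv 0,1,-1\pmod 3$, for any integer $j$. For a formal Laurent series $f(z)=\sum_{k=-\infty}^{\infty}c_kz^k$ in $z$ (with coefficients $c_k$ that do not involve $z$ but may involve $q^{1/2}$), the operator $\mathcal{L}_z$ is defined by $\mathcal{L}_z(f(z))=\sum_{k=-\infty}^{\infty}\left(\frac{k}{3}\right)c_k$;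 here it is applied only to Laurent polynomials in $z$, so the sum is finite. *)

theory Defs
  imports
    "HOL-Computational_Algebra.Computational_Algebra"
    "HOL-Number_Theory.Number_Theory"
begin

text \<open>
  The coefficient field is the field of rational functions over a field of characteristic 0 in
  the indeterminate \<open>qh\<close>, which plays the role of \<open>q\<^sup>1\<^sup>/\<^sup>2\<close>. Thus
  \<open>q = qh\<^sup>2\<close>, and for an integer \<open>a\<close> the power \<open>q\<^sup>a\<^sup>/\<^sup>2\<close> is
  \<open>qh powi a\<close>.
\<close>

definition qh :: "'a::field_char_0 poly fract"
  where "qh = Fraction_Field.Fract [:0, 1:] 1"

definition qpoch :: "'b::comm_ring_1 \<Rightarrow> 'b \<Rightarrow> nat \<Rightarrow> 'b"
  where "qpoch a q n = (\<Prod>i<n. 1 - a * q ^ i)"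

definition qbinom :: "'b::field \<Rightarrow> int \<Rightarrow> int \<Rightarrow> 'b"
  where "qbinom q n k =
    (if 0 \<le> k \<and> k \<le> n
     then qpoch q q (nat n) / (qpoch q q (nat k) * qpoch q q (nat (n - k)))
     else 0)"

text \<open>
  The library's Legendre symbol, being defined through quadratic residues, agrees with
  the residues \<open>0, 1, -1\<close> modulo 3.
\<close>

lemma Legendre_3:
  "Legendre j 3 = (if j mod 3 = 0 then 0 else if j mod 3 = 1 then 1 else -1)"
proof -
  have *: "QuadRes 3 j" if "j mod 3 = 1"
    unfolding QuadRes_def using that by (intro exI[of _ 1]) (simp add: cong_def)
  have **: "j mod 3 \<noteq> 2" if qr: "QuadRes 3 j"
  proof -
    obtain y where y: "y\<^sup>2 mod 3 = j mod 3"
      using qr unfolding QuadRes_def cong_def by blast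
    have "y\<^sup>2 mod 3 = (y mod 3)\<^sup>2 mod 3"
      by (simp add: power_mod)
    moreover have "y mod 3 = 0 \<or> y mod 3 = 1 \<or> y mod 3 = 2"
      by presburger
    ultimately show ?thesis
      using y by auto
  qed
  have "j mod 3 = 0 \<or> j mod 3 = 1 \<or> j mod 3 = 2"
    by presburger
  then show ?thesis
    using * ** by (auto simp: Legendre_def cong_def)
qed

text \<open>
  The operator sending \<open>\<Sum>c\<^sub>k z\<^sup>k\<close> to \<open>\<Sum>(k/3) c\<^sub>k\<close>, where \<open>z\<close> is \<^const>\<open>fls_X\<close>.
  It is meaningful for Laurent polynomials only: the sum ranges over the support of the series,
  and returns the junk value 0 if that support is infinite.
\<close>

definition Lz :: "'b::comm_ring_1 fls \<Rightarrow> 'b"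
  where "Lz f = (\<Sum>k | fls_nth f k \<noteq> 0. of_int (Legendre k 3) * fls_nth f k)"

end

theory Submission
  imports Defs
begin

text \<open>
  Put \<open>w = \<epsilon>z\<close>, \<open>t = -s/2\<close> and \<open>M = m - t\<close>. By the \<open>q\<close>-binomial theorem
  \<open>\<Sum>\<^sub>k w\<^sup>k q\<^bsup>k(k+s)/2\<^esup> [n+m, n+k]\<close> is, up to the factor \<open>q\<^bsup>-t^2/2\<^esup> w\<^sup>t\<close>, the product of
  \<open>(-q\<^bsup>1/2\<^esup>w; q)\<^sub>M\<close> and \<open>(-q\<^bsup>1/2\<^esup>/w; q)\<^bsub>n+t\<^esub>\<close>. The operator \<open>\<L>\<^sub>z\<close> kills every multiple of
  \<open>z + 1 + 1/z\<close>, so inside it the paired factor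
  \<open>(1 + xw)(1 + x/w) = 1 - \<epsilon>x + x\<^sup>2 + \<epsilon>x(z + 1 + 1/z)\<close> acts as the scalar
  \<open>1 - \<epsilon>x + x\<^sup>2 = (1 + \<epsilon>x\<^sup>3)/(1 + \<epsilon>x)\<close>. Pairing off the first \<open>M\<close> factors produces the
  quotient of shifted factorials; the \<open>n - m - s\<close> unpaired factors stay inside \<open>\<L>\<^sub>z\<close>.
\<close>

section \<open>Shifted factorials and the \<open>q\<close>-binomial theorem\<close>

lemma qpoch_Suc: "qpoch a q (Suc n) = qpoch a q n * (1 - a * q ^ n)"
  by (simp add: qpoch_def)

lemma qpoch_split: "qpoch a q (m + n) = qpoch a q m * qpoch (a * q ^ m) q n"
proof (induction n)
  case (Suc n)
  then show ?case
    by (simp add: qpoch_Suc power_add mult_ac)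
qed (simp add: qpoch_def)

lemma qpoch_self_nonzero:
  fixes q :: "'b::field"
  assumes "\<And>i. i > 0 \<Longrightarrow> q ^ i \<noteq> 1"
  shows "qpoch q q n \<noteq> 0"
  using assms[of "Suc _"] by (auto simp: qpoch_def)

text \<open>Of the two \<open>q\<close>-Pascal rules, this is the one that matches splitting off the
  last factor \<open>1 + y * q ^ n\<close> of the product in the \<open>q\<close>-binomial
  theorem.\<close>

lemma qbinom_Suc:
  fixes q :: "'b::field"
  assumes q: "\<And>i. i > 0 \<Longrightarrow> q ^ i \<noteq> 1" and "0 \<le> k"
  shows "qbinom q (int (Suc n)) k = qbinom q (int n) k + q ^ nat (int (Suc n) - k) * qbinom q (int n) (k - 1)"
proof -
  note nz = qpoch_self_nonzero[OF q]
  consider "k = 0" | "k = int n + 1" | "k > int n + 1" | "1 \<le> k \<and> k \<le> int n"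
    using \<open>0 \<le> k\<close> by linarith
  then show ?thesis
  proof cases
    case 4
    \<comment> \<open>With \<open>k = a + 1\<close> and \<open>n = a + b + 1\<close>, clearing
      factorials reduces the rule to
      \<open>1 - q^(a+b+2) = (1 - q^(b+1)) + q^(b+1) * (1 - q^(a+1))\<close>.\<close>
    define a where "a = nat (k - 1)"
    define b where "b = nat (int n - k)"
    have k: "k = int (Suc a)" and n: "n = Suc (a + b)"
      using 4 by (auto simp: a_def b_def)
    have "1 - q ^ Suc a \<noteq> 0" "1 - q ^ Suc b \<noteq> 0"
      using q[of "Suc a"] q[of "Suc b"] by auto
    then show ?thesis
      using nz[of a] nz[of b]
      by (simp add: qbinom_def k n nat_diff_distrib qpoch_Suc flip: of_nat_Suc)
         (simp add: divide_simps, simp add: algebra_simps power_add)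
  qed (use nz in \<open>auto simp: qbinom_def nat_add_distrib\<close>)
qed

text \<open>Supplies the ratio of consecutive coefficients \<open>q ^ (j * (j - 1) div 2)\<close>.
  At \<open>j = 0\<close> the truncated \<open>j - 1\<close> does no harm, being multiplied by
  0.\<close>

lemma triangle_Suc: "Suc j * j div 2 = j + j * (j - 1) div 2"
proof (cases j)
  case (Suc i)
  have "Suc (Suc i) * Suc i = Suc i * i + Suc i * 2" by simp
  then show ?thesis using Suc by simp
qed simp

lemma qbinom_theorem:
  fixes q y :: "'b::field"
  assumes q: "\<And>i. i > 0 \<Longrightarrow> q ^ i \<noteq> 1"
  shows "qpoch (- y) q n = (\<Sum>j\<le>n. q ^ (j * (j - 1) div 2) * qbinom q (int n) (int j) * y ^ j)"
proof (induction n)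
  case 0
  then show ?case by (simp add: qpoch_def qbinom_def)
next
  case (Suc n)
  define c where "c j = q ^ (j * (j - 1) div 2)" for j
  have c_Suc: "c (Suc j) = c j * q ^ j" for j
    using triangle_Suc[of j] by (simp add: c_def power_add)
  have "(\<Sum>j\<le>Suc n. c j * qbinom q (int (Suc n)) (int j) * y ^ j)
      = (\<Sum>j\<le>Suc n. c j * qbinom q (int n) (int j) * y ^ j)
        + (\<Sum>j\<le>Suc n. c j * (q ^ (Suc n - j) * qbinom q (int n) (int j - 1)) * y ^ j)"
    unfolding sum.distrib[symmetric]
  proof (intro sum.cong refl)
    fix j
    have "nat (int (Suc n) - int j) = Suc n - j"
      by linarith
    then have "qbinom q (int (Suc n)) (int j)
        = qbinom q (int n) (int j) + q ^ (Suc n - j) * qbinom q (int n) (int j - 1)"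
      using qbinom_Suc[OF q, of "int j" n] by simp
    then show "c j * qbinom q (int (Suc n)) (int j) * y ^ j
        = c j * qbinom q (int n) (int j) * y ^ j
          + c j * (q ^ (Suc n - j) * qbinom q (int n) (int j - 1)) * y ^ j"
      by (simp only: distrib_left distrib_right)
  qed
  \<comment> \<open>The extra term \<open>j = Suc n\<close> vanishes because its lower index exceeds
    \<open>n\<close>.\<close>
  also have "(\<Sum>j\<le>Suc n. c j * qbinom q (int n) (int j) * y ^ j) = qpoch (- y) q n"
    by (simp add: Suc c_def) (simp add: qbinom_def)
  \<comment> \<open>Index shift by one; the dropped term \<open>j = 0\<close> has lower index -1,
    where \<open>qbinom\<close> is 0.\<close>
  also have "(\<Sum>j\<le>Suc n. c j * (q ^ (Suc n - j) * qbinom q (int n) (int j - 1)) * y ^ j)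
      = (\<Sum>j\<le>n. c (Suc j) * (q ^ (n - j) * qbinom q (int n) (int j)) * y ^ Suc j)"
    by (subst sum.atMost_Suc_shift) (simp add: qbinom_def)
  also have "\<dots> = (\<Sum>j\<le>n. y * q ^ n * (c j * qbinom q (int n) (int j) * y ^ j))"
  proof (intro sum.cong refl)
    fix j assume "j \<in> {..n}"
    then have "q ^ n = q ^ j * q ^ (n - j)"
      by (simp flip: power_add)
    then show "c (Suc j) * (q ^ (n - j) * qbinom q (int n) (int j)) * y ^ Suc j
        = y * q ^ n * (c j * qbinom q (int n) (int j) * y ^ j)"
      by (simp add: c_Suc)
  qed
  also have "\<dots> = y * q ^ n * qpoch (- y) q n"
    by (simp add: Suc c_def sum_distrib_left)
  finally show ?case
    by (simp add: c_def qpoch_Suc algebra_simps)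
qed

section \<open>The finite triple product\<close>

lemma prod_odd_powers: "(\<Prod>i<n. x ^ (2 * i + 1)) = (x::'b::comm_monoid_mult) ^ (n ^ 2)"
proof (induction n)
  case (Suc n)
  have "(Suc n)\<^sup>2 = n\<^sup>2 + (2 * n + 1)"
    by (simp add: power2_eq_square)
  then show ?case
    using Suc by (simp only: prod.lessThan_Suc power_add)
qed simp

text \<open>
  Reversing the order of a block of \<open>n + t\<close> factors in the \<open>q\<close>-binomial theorem, as in
  the usual derivation of the finite Jacobi triple product.
\<close>

lemma finite_triple_product:
  fixes h w :: "'b::field"
  assumes h: "\<And>i. i > 0 \<Longrightarrow> h ^ i \<noteq> 1" and "h \<noteq> 0" and "w \<noteq> 0"
  shows "(\<Sum>k = - int n..int (M + t). w powi k * h powi (k\<^sup>2 - 2 * int t * k)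
            * qbinom (h\<^sup>2) (int n + int (M + t)) (int n + k))
       = w ^ t * h powi (- (int t)\<^sup>2) * qpoch (- h * w) (h\<^sup>2) M * qpoch (- h / w) (h\<^sup>2) (n + t)"
proof -
  \<comment> \<open>\<open>y\<close> is chosen so that after \<open>n + t\<close> factors the
    running term \<open>y * (h\<^sup>2) ^ (n + t)\<close> is exactly \<open>h * w\<close>.
    \<open>C\<close> compensates for the index shift \<open>j = k + n\<close>, since
    \<open>(k + n) * (k + n - 2(n + t)) = k^2 - 2tk - n^2 - 2tn\<close>.\<close>
  define y where "y = w * h powi (1 - 2 * int (n + t))"
  define C where "C = w ^ n * h powi (- (int n)\<^sup>2 - 2 * int t * int n)"
  have q: "(h\<^sup>2) ^ i \<noteq> 1" if "i > 0" for i
    using h[of "2 * i"] that by (simp add: power_mult)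
  have h2: "(h\<^sup>2) ^ i = h powi (2 * int i)" for i
    by (metis power_mult power_int_of_nat of_nat_mult of_nat_numeral)
  have C: "C \<noteq> 0" using assms by (simp add: C_def)
  have "C * (\<Sum>k = - int n..int (M + t). w powi k * h powi (k\<^sup>2 - 2 * int t * k)
            * qbinom (h\<^sup>2) (int n + int (M + t)) (int n + k))
      = (\<Sum>k = - int n..int (M + t). w powi (k + int n) * h powi ((k + int n) * (k + int n - 2 * int (n + t)))
            * qbinom (h\<^sup>2) (int n + int (M + t)) (k + int n))"
    unfolding sum_distrib_left
  proof (intro sum.cong refl)
    fix k :: int
    have "w ^ n * w powi k = w powi (k + int n)"
      using assms by (simp add: power_int_add)
    moreover have "h powi (- (int n)\<^sup>2 - 2 * int t * int n) * h powi (k\<^sup>2 - 2 * int t * k)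
        = h powi ((k + int n) * (k + int n - 2 * int (n + t)))"
      using assms by (subst power_int_add[symmetric]) (simp_all add: algebra_simps power2_eq_square)
    moreover have "C * (w powi k * h powi (k\<^sup>2 - 2 * int t * k) * B)
        = (w ^ n * w powi k) * (h powi (- (int n)\<^sup>2 - 2 * int t * int n) * h powi (k\<^sup>2 - 2 * int t * k)) * B" for B
      by (simp only: C_def mult_ac)
    ultimately show "C * (w powi k * h powi (k\<^sup>2 - 2 * int t * k) * qbinom (h\<^sup>2) (int n + int (M + t)) (int n + k))
      = w powi (k + int n) * h powi ((k + int n) * (k + int n - 2 * int (n + t)))
            * qbinom (h\<^sup>2) (int n + int (M + t)) (k + int n)"
      by (simp only: add.commute)
  qed
  also have "\<dots> = (\<Sum>j\<le>n + (M + t). w ^ j * h powi (int j * (int j - 2 * int (n + t)))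
            * qbinom (h\<^sup>2) (int (n + (M + t))) (int j))"
    by (rule sum.reindex_bij_witness[of _ "\<lambda>j. int j - int n" "\<lambda>k. nat (k + int n)"])
       (auto simp: power_int_nonneg_exp)
  also have "\<dots> = (\<Sum>j\<le>n + (M + t). (h\<^sup>2) ^ (j * (j - 1) div 2)
            * qbinom (h\<^sup>2) (int (n + (M + t))) (int j) * y ^ j)"
  proof (intro sum.cong refl)
    fix j :: nat
    have "even (j * (j - 1))" by (cases j) auto
    then have "(h\<^sup>2) ^ (j * (j - 1) div 2) = h ^ (j * (j - 1))"
      by (simp flip: power_mult)
    also have "\<dots> = h powi (int (j * (j - 1)))"
      by (simp only: power_int_of_nat)
    also have "int (j * (j - 1)) = int j * (int j - 1)"
      by (cases j) (simp_all add: algebra_simps)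
    finally have sq: "(h\<^sup>2) ^ (j * (j - 1) div 2) = h powi (int j * (int j - 1))" .
    have "y ^ j = w ^ j * h powi ((1 - 2 * int (n + t)) * int j)"
      unfolding y_def by (simp only: power_mult_distrib power_int_mult power_int_of_nat)
    then have "(h\<^sup>2) ^ (j * (j - 1) div 2) * y ^ j
        = w ^ j * (h powi (int j * (int j - 1)) * h powi ((1 - 2 * int (n + t)) * int j))"
      using sq by (simp only: mult_ac)
    also have "h powi (int j * (int j - 1)) * h powi ((1 - 2 * int (n + t)) * int j)
        = h powi (int j * (int j - 2 * int (n + t)))"
      using assms by (subst power_int_add[symmetric]) (simp_all add: algebra_simps)
    finally have "w ^ j * h powi (int j * (int j - 2 * int (n + t))) = (h\<^sup>2) ^ (j * (j - 1) div 2) * y ^ j" ..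
    then show "w ^ j * h powi (int j * (int j - 2 * int (n + t))) * qbinom (h\<^sup>2) (int (n + (M + t))) (int j)
      = (h\<^sup>2) ^ (j * (j - 1) div 2) * qbinom (h\<^sup>2) (int (n + (M + t))) (int j) * y ^ j"
      by (simp only:) (simp only: mult_ac)
  qed
  also have "\<dots> = qpoch (- y) (h\<^sup>2) ((n + t) + M)"
    by (subst qbinom_theorem[OF q]) (simp_all add: add_ac)
  also have "\<dots> = qpoch (- y) (h\<^sup>2) (n + t) * qpoch (- h * w) (h\<^sup>2) M"
  proof -
    have "h powi (1 - 2 * int (n + t)) * (h\<^sup>2) ^ (n + t) = h powi 1"
      unfolding h2 using assms by (subst power_int_add[symmetric]) simp_all
    then have "- y * (h\<^sup>2) ^ (n + t) = - h * w"
      by (simp add: y_def)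
    then show ?thesis by (simp only: qpoch_split)
  qed
  also have "qpoch (- y) (h\<^sup>2) (n + t)
      = w ^ (n + t) * inverse (h ^ ((n + t)\<^sup>2)) * qpoch (- h / w) (h\<^sup>2) (n + t)"
  proof -
    have "qpoch (- y) (h\<^sup>2) (n + t) = (\<Prod>i<n + t. 1 + y * (h\<^sup>2) ^ (n + t - Suc i))"
      unfolding qpoch_def by (subst prod.nat_diff_reindex[symmetric]) simp
    \<comment> \<open>After the reversal, factor \<open>i\<close> is \<open>1 + w / p\<close> with
      \<open>p = h ^ (2 * i + 1)\<close>, rewritten as \<open>(w / p) * (1 + p / w)\<close>. The
      extracted odd exponents add up to \<open>(n + t)^2\<close>.\<close>
    also have "\<dots> = (\<Prod>i<n + t. w * inverse (h ^ (2 * i + 1)) * (1 - (- h / w) * (h\<^sup>2) ^ i))"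
    proof (intro prod.cong refl)
      fix i assume "i \<in> {..<n + t}"
      then have "2 * int (n + t - Suc i) = 2 * int (n + t) - 2 * int i - 2" by auto
      then have "y * (h\<^sup>2) ^ (n + t - Suc i)
          = w * (h powi (1 - 2 * int (n + t)) * h powi (2 * int (n + t) - 2 * int i - 2))"
        unfolding y_def h2 by (simp only: mult_ac)
      also have "h powi (1 - 2 * int (n + t)) * h powi (2 * int (n + t) - 2 * int i - 2) = h powi (- int (2 * i + 1))"
        using assms by (subst power_int_add[symmetric]) simp_all
      also have "\<dots> = inverse (h ^ (2 * i + 1))"
        by (simp only: power_int_minus power_int_of_nat)
      finally have y: "y * (h\<^sup>2) ^ (n + t - Suc i) = w * inverse (h ^ (2 * i + 1))" .
      have "1 - (- h / w) * (h\<^sup>2) ^ i = 1 + h ^ (2 * i + 1) / w"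
        by (simp add: power_mult)
      moreover have "1 + w * inverse p = w * inverse p * (1 + p / w)" if "p \<noteq> 0" for p
        using that \<open>w \<noteq> 0\<close> by (simp add: field_simps)
      then have "1 + w * inverse (h ^ (2 * i + 1)) = w * inverse (h ^ (2 * i + 1)) * (1 + h ^ (2 * i + 1) / w)"
        using \<open>h \<noteq> 0\<close> by (metis power_not_zero)
      ultimately show "1 + y * (h\<^sup>2) ^ (n + t - Suc i)
          = w * inverse (h ^ (2 * i + 1)) * (1 - (- h / w) * (h\<^sup>2) ^ i)"
        using y by (simp only:)
    qed
    also have "\<dots> = w ^ (n + t) * inverse (h ^ ((n + t)\<^sup>2)) * qpoch (- h / w) (h\<^sup>2) (n + t)"
      unfolding qpoch_def by (simp only: prod.distrib prod_inversef[unfolded o_def] prod_odd_powers) simp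
    finally show ?thesis .
  qed
  \<comment> \<open>Since \<open>(n + t)^2 = n^2 + 2nt + t^2\<close>, the extracted monomial
    contains \<open>C\<close>, which then cancels.\<close>
  also have "w ^ (n + t) * inverse (h ^ ((n + t)\<^sup>2)) = C * (w ^ t * h powi (- (int t)\<^sup>2))"
  proof -
    have "h powi (- (int n)\<^sup>2 - 2 * int t * int n) * h powi (- (int t)\<^sup>2) = h powi (- int ((n + t)\<^sup>2))"
      using assms by (subst power_int_add[symmetric]) (simp_all add: algebra_simps power2_eq_square)
    then show ?thesis
      unfolding C_def power_int_minus power_int_of_nat power_add by (simp add: mult_ac)
  qed
  finally show ?thesis
    using C by (simp add: mult_ac)
qed

section \<open>Laurent polynomials and the operator \<open>Lz\<close>\<close>

lemma fls_const_qpoch: "fls_const (qpoch a q n) = qpoch (fls_const a) (fls_const q) n"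
  by (induction n) (simp_all add: qpoch_def fls_const_power flip: fls_const_mult_const fls_minus_const)

lemma fls_const_qbinom: "fls_const (qbinom (q::'b::field) n k) = qbinom (fls_const q) n k"
  by (simp add: qbinom_def fls_const_divide_const flip: fls_const_qpoch)

text \<open>On infinite supports \<open>Lz\<close> takes the value 0 by default and is not additive,
  so finiteness of the support has to be carried through every use of linearity.\<close>

definition laurent_poly :: "'b::zero fls \<Rightarrow> bool"
  where "laurent_poly f \<longleftrightarrow> finite {k. fls_nth f k \<noteq> 0}"

lemma laurent_poly_one: "laurent_poly (1 :: 'b::{zero,one} fls)"
  unfolding laurent_poly_def by (rule finite_subset[of _ "{0}"]) auto

lemma laurent_poly_add:
  assumes "laurent_poly f" "laurent_poly g"
  shows "laurent_poly (f + g :: 'b::comm_ring_1 fls)"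
  using finite_UnI[OF assms[unfolded laurent_poly_def]]
  unfolding laurent_poly_def by (rule finite_subset[rotated]) auto

lemma laurent_poly_const_mult:
  assumes "laurent_poly f"
  shows "laurent_poly (fls_const c * f :: 'b::comm_ring_1 fls)"
  using assms unfolding laurent_poly_def by (rule finite_subset[rotated]) auto

lemma laurent_poly_shift:
  assumes "laurent_poly f"
  shows "laurent_poly (fls_shift i f)"
proof -
  have "{k. fls_nth (fls_shift i f) k \<noteq> 0} \<subseteq> (\<lambda>k. k - i) ` {k. fls_nth f k \<noteq> 0}"
  proof
    fix k assume "k \<in> {k. fls_nth (fls_shift i f) k \<noteq> 0}"
    then show "k \<in> (\<lambda>k. k - i) ` {k. fls_nth f k \<noteq> 0}"
      by (intro image_eqI[of _ _ "k + i"]) auto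
  qed
  then show ?thesis
    using assms unfolding laurent_poly_def by (rule finite_subset[OF _ finite_imageI])
qed

text \<open>Allows several series with different supports to be summed over one common index
  set.\<close>

lemma Lz_eq_sum:
  assumes "finite A" "\<And>k. fls_nth f k \<noteq> 0 \<Longrightarrow> k \<in> A"
  shows "Lz f = (\<Sum>k\<in>A. of_int (Legendre k 3) * fls_nth f k)"
  unfolding Lz_def using assms by (intro sum.mono_neutral_left) auto

lemma Lz_add:
  assumes "laurent_poly f" "laurent_poly g"
  shows "Lz (f + g) = Lz f + Lz g"
proof -
  let ?A = "{k. fls_nth f k \<noteq> 0} \<union> {k. fls_nth g k \<noteq> 0}"
  have A: "finite ?A" using assms by (simp add: laurent_poly_def)
  show ?thesis
    by (subst (1 2 3) Lz_eq_sum[OF A]) (auto simp: sum.distrib distrib_left)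
qed

lemma Lz_const_mult:
  assumes "laurent_poly f"
  shows "Lz (fls_const c * f) = c * Lz f"
proof -
  have A: "finite {k. fls_nth f k \<noteq> 0}" using assms by (simp add: laurent_poly_def)
  show ?thesis
    by (subst (1 2) Lz_eq_sum[OF A]) (auto simp: sum_distrib_left mult_ac)
qed

text \<open>The shift is multiplication by \<open>z ^ i\<close>. Indexing by the support of
  \<open>f\<close> itself lets different shifts of \<open>f\<close> be added term by term.\<close>

lemma Lz_shift:
  "Lz (fls_shift (- i) f) = (\<Sum>k | fls_nth f k \<noteq> 0. of_int (Legendre (k + i) 3) * fls_nth f k)"
  unfolding Lz_def
  by (rule sum.reindex_bij_witness[of _ "\<lambda>k. k + i" "\<lambda>k. k - i"]) auto

text \<open>Since \<open>fls_shift (- (k + d)) 1\<close> is \<open>z ^ (k + d)\<close>, this is how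
  the Legendre symbols of the target sum arise from \<open>Lz\<close>.\<close>

lemma Lz_sum_monomials:
  fixes c :: "int \<Rightarrow> 'b::comm_ring_1"
  assumes "finite A"
  shows "Lz (\<Sum>k\<in>A. fls_const (c k) * fls_shift (- (k + d)) 1)
    = (\<Sum>k\<in>A. of_int (Legendre (k + d) 3) * c k)"
proof -
  have lp: "laurent_poly (fls_const (c k) * fls_shift (- (k + d)) 1)" for k
    by (intro laurent_poly_const_mult laurent_poly_shift laurent_poly_one)
  have "{k. fls_nth (1 :: 'b fls) k \<noteq> 0} = {0}" by auto
  then have Lz1: "Lz (fls_shift (- j) (1 :: 'b fls)) = of_int (Legendre j 3)" for j
    by (simp add: Lz_shift)
  have "Lz (\<Sum>k\<in>A. fls_const (c k) * fls_shift (- (k + d)) 1)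
      = (\<Sum>k\<in>A. of_int (Legendre (k + d) 3) * c k)
    \<and> laurent_poly (\<Sum>k\<in>A. fls_const (c k) * fls_shift (- (k + d)) 1)"
    using assms
  proof (induction A)
    case empty
    then show ?case by (simp add: Lz_def laurent_poly_def)
  next
    case (insert k A)
    have "Lz (fls_const (c k) * fls_shift (- (k + d)) 1) = c k * of_int (Legendre (k + d) 3)"
      by (simp only: Lz_const_mult[OF laurent_poly_shift[OF laurent_poly_one]] Lz1)
    then show ?case
      unfolding sum.insert[OF insert.hyps]
      using insert.IH by (simp only: Lz_add[OF lp] laurent_poly_add[OF lp] mult.commute)
  qed
  then show ?thesis ..
qed

lemma Legendre_3_consecutive: "Legendre (k + 1) 3 + Legendre k 3 + Legendre (k - 1) 3 = 0"
proof -
  have "k mod 3 = 0 \<or> k mod 3 = 1 \<or> k mod 3 = 2" by presburger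
  then show ?thesis
  proof (elim disjE)
    assume k: "k mod 3 = 0"
    then have "(k + 1) mod 3 = 1" "(k - 1) mod 3 = 2" by presburger+
    with k show ?thesis by (simp only: Legendre_3) simp
  next
    assume k: "k mod 3 = 1"
    then have "(k + 1) mod 3 = 2" "(k - 1) mod 3 = 0" by presburger+
    with k show ?thesis by (simp only: Legendre_3) simp
  next
    assume k: "k mod 3 = 2"
    then have "(k + 1) mod 3 = 0" "(k - 1) mod 3 = 1" by presburger+
    with k show ?thesis by (simp only: Legendre_3) simp
  qed
qed

text \<open>The argument is \<open>(z + 1 + 1/z) * f\<close>. Each coefficient of \<open>f\<close>
  is weighted by three consecutive Legendre symbols, which sum to 0.\<close>

lemma Lz_kernel:
  assumes "laurent_poly f"
  shows "Lz (fls_shift (- 1) f + f + fls_shift 1 f) = (0 :: 'b::comm_ring_1)"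
proof -
  have "Lz (fls_shift (- 1) f + f + fls_shift 1 f)
      = Lz (fls_shift (- 1) f) + Lz (fls_shift (- 0) f) + Lz (fls_shift (- (- 1)) f)"
    using assms by (simp add: Lz_add laurent_poly_add laurent_poly_shift)
  also have "\<dots> = (\<Sum>k | fls_nth f k \<noteq> 0.
      of_int (Legendre (k + 1) 3 + Legendre k 3 + Legendre (k - 1) 3) * fls_nth f k)"
    unfolding Lz_shift by (simp add: sum.distrib distrib_right)
  finally show ?thesis by (simp add: Legendre_3_consecutive)
qed

section \<open>Pairing the factors in \<open>w\<close> and \<open>1 / w\<close>\<close>

lemma Lz_quadratic_factor:
  fixes x e :: "'b::field"
  assumes e: "e * e = 1" and g: "laurent_poly g"
  defines "w \<equiv> fls_const e * fls_X"
  shows "Lz ((1 + fls_const x * w) * (1 + fls_const x / w) * g) = (1 - e * x + (e * x)\<^sup>2) * Lz g"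
    and "laurent_poly ((1 + fls_const x * w) * (1 + fls_const x / w) * g)"
proof -
  define z where "z = (fls_X :: 'b fls)"
  have ee: "fls_const e * fls_const e = 1" using e by simp
  then have inv_e: "inverse (fls_const e) = fls_const e"
    by (metis inverse_unique)
  have z: "z * inverse z = 1" by (simp add: z_def)
  have w: "inverse w = fls_const e * inverse z"
    by (simp add: w_def z_def inv_e)
  have "(1 + fls_const x * w) * (1 + fls_const x / w) * g
      = (1 + (fls_const e * fls_const e) * (fls_const x * fls_const x) * (z * inverse z)
          + fls_const e * fls_const x * (z + inverse z)) * g"
    unfolding divide_inverse w by (simp add: w_def z_def algebra_simps)
  \<comment> \<open>Adding and subtracting \<open>e * x\<close> completes \<open>z + 1/z\<close> to
    the kernel element \<open>z + 1 + 1/z\<close>.\<close>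
  also have "\<dots> = (1 - fls_const e * fls_const x + (fls_const e * fls_const e) * fls_const x * fls_const x) * g
      + fls_const e * fls_const x * (z * g + g + inverse z * g)"
    unfolding z by (simp add: algebra_simps)
  also have "\<dots> = fls_const (1 - e * x + (e * x)\<^sup>2) * g
      + fls_const (e * x) * (fls_shift (- 1) g + g + fls_shift 1 g)"
  proof -
    have "1 - fls_const e * fls_const x + (fls_const e * fls_const e) * fls_const x * fls_const x
        = fls_const (1 - e * x + (e * x)\<^sup>2)"
      by (simp add: fls_plus_const fls_minus_const power2_eq_square mult_ac flip: fls_const_1)
    moreover have "z * g = fls_shift (- 1) g" "inverse z * g = fls_shift 1 g"
      by (simp_all add: z_def fls_inverse_X fls_X_times_conv_shift fls_X_inv_times_conv_shift)
    ultimately show ?thesis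
      by (simp only: fls_const_mult_const)
  qed
  finally have eq: "(1 + fls_const x * w) * (1 + fls_const x / w) * g
     = fls_const (1 - e * x + (e * x)\<^sup>2) * g
      + fls_const (e * x) * (fls_shift (- 1) g + g + fls_shift 1 g)" .
  have lp: "laurent_poly (fls_shift (- 1) g + g + fls_shift 1 g)"
    using g by (intro laurent_poly_add laurent_poly_shift)
  show "laurent_poly ((1 + fls_const x * w) * (1 + fls_const x / w) * g)"
    unfolding eq using g by (intro laurent_poly_add laurent_poly_const_mult laurent_poly_shift)
  show "Lz ((1 + fls_const x * w) * (1 + fls_const x / w) * g) = (1 - e * x + (e * x)\<^sup>2) * Lz g"
    unfolding eq Lz_add[OF laurent_poly_const_mult[OF g] laurent_poly_const_mult[OF lp]]
      Lz_const_mult[OF g] Lz_const_mult[OF lp] Lz_kernel[OF g] by simp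
qed

text \<open>Induction peels off one pair at a time, with \<open>x = h ^ (2 * M + 1)\<close>. The
  denominator is multiplied out, so zeros of \<open>1 + e * x\<close> cause no trouble; finite
  support is carried along for the linearity of \<open>Lz\<close>.\<close>

lemma Lz_qpoch_pair:
  fixes h e :: "'b::field"
  assumes e: "e * e = 1" and g: "laurent_poly g"
  defines "w \<equiv> fls_const e * fls_X"
  defines "P \<equiv> \<lambda>M. qpoch (- fls_const h * w) (fls_const (h\<^sup>2)) M * qpoch (- fls_const h / w) (fls_const (h\<^sup>2)) M * g"
  shows "Lz (P M) * qpoch (- e * h) (h\<^sup>2) M = qpoch (- e * h ^ 3) ((h\<^sup>2) ^ 3) M * Lz g \<and> laurent_poly (P M)"
proof (induction M)
  case 0
  then show ?case using g by (simp add: P_def qpoch_def)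
next
  case (Suc M)
  define x where "x = h * (h\<^sup>2) ^ M"
  have x: "fls_const x = fls_const h * fls_const (h\<^sup>2) ^ M"
    by (simp only: x_def fls_const_power fls_const_mult_const[symmetric])
  have P: "P (Suc M) = (1 + fls_const x * w) * (1 + fls_const x / w) * P M"
    by (simp add: P_def qpoch_Suc x mult_ac)
  \<comment> \<open>Thus \<open>(e * x) ^ 3 = e * x ^ 3\<close>: the sign survives cubing while the
    base passes from \<open>h\<^sup>2\<close> to its cube.\<close>
  have "e ^ 3 = e" using e by (simp add: power3_eq_cube)
  then have "(e * x) ^ 3 = e * h ^ 3 * ((h\<^sup>2) ^ 3) ^ M"
    unfolding x_def power_mult_distrib by (simp add: mult.commute flip: power_mult)
  then have cube: "(1 - e * x + (e * x)\<^sup>2) * (1 + e * x) = 1 + e * h ^ 3 * ((h\<^sup>2) ^ 3) ^ M"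
    by (simp add: algebra_simps power2_eq_square power3_eq_cube)
  have "Lz (P (Suc M)) * qpoch (- e * h) (h\<^sup>2) (Suc M)
      = ((1 - e * x + (e * x)\<^sup>2) * (1 + e * x)) * (Lz (P M) * qpoch (- e * h) (h\<^sup>2) M)"
    using Suc unfolding P w_def by (subst Lz_quadratic_factor[OF e]) (simp_all add: qpoch_Suc x_def mult_ac)
  also have "\<dots> = qpoch (- e * h ^ 3) ((h\<^sup>2) ^ 3) (Suc M) * Lz g"
    unfolding cube using Suc by (simp add: qpoch_Suc mult_ac)
  finally show ?case
    using Suc Lz_quadratic_factor(2)[OF e, of "P M" x] unfolding P w_def by blast
qed

text \<open>Covers the unpaired factors: each new one adds a scaled copy of the series shifted down
  by one, so the support stays finite.\<close>

lemma laurent_poly_powi_qpoch: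
  fixes a e c :: "'b::field"
  shows "laurent_poly (fls_const c * (fls_const e * fls_X) powi j * qpoch (fls_const a / fls_X) (fls_const b) r)"
proof (induction r)
  case 0
  have "fls_const c * (fls_const e * fls_X) powi j = fls_const (c * e powi j) * fls_shift (- j) 1"
    by (simp add: power_int_mult_distrib fls_X_power_int flip: fls_const_power_int)
  then show ?case
    by (simp add: qpoch_def laurent_poly_const_mult laurent_poly_shift laurent_poly_one)
next
  case (Suc r)
  let ?f = "fls_const c * (fls_const e * fls_X) powi j * qpoch (fls_const a / fls_X) (fls_const b) r"
  have "fls_const c * (fls_const e * fls_X) powi j * qpoch (fls_const a / fls_X) (fls_const b) (Suc r)
      = ?f + fls_const (- a) * (fls_const b ^ r * (inverse fls_X * ?f))"
    by (simp add: qpoch_Suc divide_inverse algebra_simps)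
  also have "\<dots> = ?f + fls_const (- a) * (fls_const (b ^ r) * fls_shift 1 ?f)"
    by (simp only: fls_const_power fls_inverse_X fls_X_inv_times_conv_shift)
  finally show ?case
    using Suc by (simp only: laurent_poly_add laurent_poly_const_mult laurent_poly_shift)
qed

section \<open>The identity over a general field, with the denominator multiplied out\<close>

lemma Legendre_qbinom_sum:
  fixes h e :: "'b::field"
  assumes h: "\<And>i. i > 0 \<Longrightarrow> h ^ i \<noteq> 1" and "h \<noteq> 0" and e: "e * e = 1" and r: "n + t = M + r"
  shows "(\<Sum>k = - int n..int (M + t). e powi (k + d) * of_int (Legendre (k + d) 3)
            * h powi (k\<^sup>2 - 2 * int t * k) * qbinom (h\<^sup>2) (int n + int (M + t)) (int n + k))
         * qpoch (- e * h) (h\<^sup>2) M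
       = qpoch (- e * h ^ 3) ((h\<^sup>2) ^ 3) M
         * Lz (fls_const (h powi (- (int t)\<^sup>2)) * (fls_const e * fls_X) powi (d + int t)
               * qpoch (fls_const (- e * (h * (h\<^sup>2) ^ M)) / fls_X) (fls_const (h\<^sup>2)) r)"
proof -
  define w where "w = fls_const e * fls_X"
  define H where "H = fls_const h"
  define g where "g = fls_const (h powi (- (int t)\<^sup>2)) * (fls_const e * fls_X) powi (d + int t)
               * qpoch (fls_const (- e * (h * (h\<^sup>2) ^ M)) / fls_X) (fls_const (h\<^sup>2)) r"
  have "e \<noteq> 0" using e by auto
  then have w0: "w \<noteq> 0" by (simp add: w_def)
  have H0: "H \<noteq> 0" using \<open>h \<noteq> 0\<close> by (simp add: H_def)
  have H2: "H\<^sup>2 = fls_const (h\<^sup>2)" by (simp add: H_def fls_const_power)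
  \<comment> \<open>The triple product will be applied inside the field of Laurent series, so its
    hypotheses are transferred from \<open>h\<close> to the constant series
    \<open>H\<close>.\<close>
  have H1: "H ^ i \<noteq> 1" if "i > 0" for i
    using h[OF that] by (metis H_def fls_const_power fls_const_nth fls_const_1)
  have "inverse (fls_const e) = fls_const e"
    by (rule inverse_unique) (simp add: e)
  then have tail: "- H / w * (H\<^sup>2) ^ M = fls_const (- e * (h * (h\<^sup>2) ^ M)) / fls_X"
    by (simp add: w_def H_def divide_inverse fls_const_power mult_ac flip: fls_const_mult_const)
  have pre: "H powi (- (int t)\<^sup>2) = fls_const (h powi (- (int t)\<^sup>2))"
    by (simp only: H_def fls_const_power_int)
  \<comment> \<open>Here \<open>w powi (k + d)\<close> splits into the sign
    \<open>e powi (k + d)\<close> and the monomial \<open>z ^ (k + d)\<close>.\<close>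
  have "(\<Sum>k = - int n..int (M + t). fls_const (e powi (k + d) * h powi (k\<^sup>2 - 2 * int t * k)
            * qbinom (h\<^sup>2) (int n + int (M + t)) (int n + k)) * fls_shift (- (k + d)) 1)
      = w powi d * (\<Sum>k = - int n..int (M + t). w powi k * H powi (k\<^sup>2 - 2 * int t * k)
            * qbinom (H\<^sup>2) (int n + int (M + t)) (int n + k))"
    unfolding sum_distrib_left
  proof (intro sum.cong refl)
    fix k
    have "w powi d * w powi k = w powi (k + d)"
      using w0 by (simp add: power_int_add)
    also have "\<dots> = fls_const (e powi (k + d)) * fls_shift (- (k + d)) 1"
      by (simp only: w_def power_int_mult_distrib fls_X_power_int fls_const_power_int)
    finally have ww: "w powi d * w powi k = fls_const (e powi (k + d)) * fls_shift (- (k + d)) 1" .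
    show "fls_const (e powi (k + d) * h powi (k\<^sup>2 - 2 * int t * k)
            * qbinom (h\<^sup>2) (int n + int (M + t)) (int n + k)) * fls_shift (- (k + d)) 1
      = w powi d * (w powi k * H powi (k\<^sup>2 - 2 * int t * k)
            * qbinom (H\<^sup>2) (int n + int (M + t)) (int n + k))"
      unfolding mult.assoc[symmetric] ww
      unfolding H2
      unfolding H_def fls_const_power_int[symmetric] fls_const_qbinom[symmetric] fls_const_mult_const[symmetric]
      by (simp only: mult_ac)
  qed
  also have "\<dots> = w powi d * (w ^ t * H powi (- (int t)\<^sup>2) * qpoch (- H * w) (H\<^sup>2) M * qpoch (- H / w) (H\<^sup>2) (n + t))"
    by (subst finite_triple_product[OF H1 H0 w0]) simp_all
  \<comment> \<open>Of the \<open>n + t = M + r\<close> factors in \<open>1 / w\<close>, the first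
    \<open>M\<close> are paired with those in \<open>w\<close>; the other \<open>r\<close> go into
    \<open>g\<close>.\<close>
  also have "\<dots> = qpoch (- H * w) (H\<^sup>2) M * qpoch (- H / w) (H\<^sup>2) M
      * (H powi (- (int t)\<^sup>2) * w powi (d + int t) * qpoch (- H / w * (H\<^sup>2) ^ M) (H\<^sup>2) r)"
    unfolding r qpoch_split using w0 by (simp add: power_int_add mult_ac)
  also have "\<dots> = qpoch (- H * w) (H\<^sup>2) M * qpoch (- H / w) (H\<^sup>2) M * g"
    unfolding tail pre unfolding H2 w_def g_def ..
  finally have "Lz (qpoch (- H * w) (H\<^sup>2) M * qpoch (- H / w) (H\<^sup>2) M * g)
      = (\<Sum>k = - int n..int (M + t). of_int (Legendre (k + d) 3) * (e powi (k + d) * h powi (k\<^sup>2 - 2 * int t * k)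
            * qbinom (h\<^sup>2) (int n + int (M + t)) (int n + k)))"
    by (subst Lz_sum_monomials[symmetric]) simp_all
  moreover have "laurent_poly g"
    unfolding g_def by (rule laurent_poly_powi_qpoch)
  ultimately show ?thesis
    using Lz_qpoch_pair[OF e, of g h M] unfolding g_def[symmetric] H2 by (simp add: H_def w_def mult_ac)
qed

section \<open>Specialization to rational functions in \<open>qh\<close>\<close>

text \<open>Powers of \<open>qh\<close> become monomials, whose degrees show that \<open>qh\<close>
  is not a root of unity.\<close>

lemma qh_power: "(qh :: 'a::field_char_0 poly fract) ^ i = to_fract (Polynomial.monom 1 i)"
proof (induction i)
  case (Suc i)
  have "(qh :: 'a poly fract) = to_fract (Polynomial.monom 1 1)"
    by (simp add: qh_def to_fract_def monom_altdef)
  then have "(qh :: 'a poly fract) ^ Suc i = to_fract (Polynomial.monom 1 1) * to_fract (Polynomial.monom 1 i)"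
    by (simp only: power_Suc Suc.IH)
  also have "\<dots> = to_fract (Polynomial.monom 1 (Suc i))"
    by (simp add: mult_monom flip: to_fract_mult)
  finally show ?case .
qed (simp add: monom_eq_1)

lemma qh_power_neq_1: "i > 0 \<Longrightarrow> (qh :: 'a::field_char_0 poly fract) ^ i \<noteq> 1"
  by (metis qh_power to_fract_1 to_fract_eq_iff degree_1 degree_monom_eq less_irrefl one_neq_zero)

text \<open>A zero factor would give \<open>e * qh ^ (2 * i + 1) = - 1\<close>; squaring removes
  \<open>e\<close> and makes \<open>qh\<close> a root of unity.\<close>

lemma qpoch_qh_nonzero:
  fixes e :: "'a::field_char_0 poly fract"
  assumes "e * e = 1"
  shows "qpoch (- e * qh) (qh\<^sup>2) M \<noteq> 0"
proof -
  have "1 - - e * qh * (qh\<^sup>2) ^ i \<noteq> 0" for i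
  proof
    assume "1 - - e * qh * (qh\<^sup>2) ^ i = 0"
    then have "e * qh ^ (2 * i + 1) = - 1"
      by (simp add: eq_neg_iff_add_eq_0 add.commute mult.assoc flip: power_mult)
    then have "(e * e) * (qh ^ (2 * i + 1) * qh ^ (2 * i + 1)) = 1"
      by (metis (no_types, lifting) mult.assoc mult.left_commute minus_mult_minus mult_1)
    then have "(qh :: 'a poly fract) ^ (4 * i + 2) = 1"
      unfolding assms power_add[symmetric] by (simp add: mult_2[symmetric] algebra_simps)
    then show False using qh_power_neq_1[of "4 * i + 2", where 'a = 'a] by simp
  qed
  then show ?thesis by (simp add: qpoch_def)
qed

theorem theorem1p2:
  fixes q :: "'a::field_char_0 poly fract" and \<epsilon> d s n m :: int
  assumes q: "q = qh ^ 2"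
    and "\<epsilon> \<in> {1, -1}"
    and "d \<in> {0, 1, 2}"
    and "s \<le> 0" and "even s"
    and "n > 0" and "m > 0"
    and "- (s div 2) \<le> m" and "m \<le> n - s"
  shows "(\<Sum>k = -n..m. of_int \<epsilon> powi (k + d) * of_int (Legendre (k + d) 3)
            * qh powi (k\<^sup>2 + s * k) * qbinom q (n + m) (n + k))
       = qpoch (- of_int \<epsilon> * qh ^ 3) (q ^ 3) (nat (m + s div 2))
           / qpoch (- of_int \<epsilon> * qh) q (nat (m + s div 2))
         * Lz (fls_const (qh powi (- ((s div 2)\<^sup>2)))
               * (of_int \<epsilon> * fls_X) powi (d - s div 2)
               * qpoch (- of_int \<epsilon> * fls_const (qh powi (2 * m + s + 1)) / fls_X)
                       (fls_const q) (nat (n - m - s)))"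
proof -
  \<comment> \<open>The bounds on \<open>s\<close> and \<open>m\<close> make \<open>-s/2\<close>,
    \<open>m + s/2\<close> and \<open>n - m - s\<close> nonnegative, so \<open>nat\<close> loses
    nothing; evenness of \<open>s\<close> makes \<open>s div 2\<close> exact.\<close>
  define t where "t = nat (- (s div 2))"
  define M where "M = nat (m + s div 2)"
  define r where "r = nat (n - m - s)"
  define N where "N = nat n"
  define e where "e = (of_int \<epsilon> :: 'a poly fract)"
  have s: "s = - 2 * int t" and s2: "s div 2 = - int t" and m: "m = int (M + t)" and n: "n = int N"
    and r: "N + t = M + r"
    using assms(4-9) by (auto simp: t_def M_def r_def N_def)
  have ee: "e * e = 1" using assms(2) by (auto simp: e_def)
  have qh0: "(qh :: 'a poly fract) \<noteq> 0"
    by (metis qh_power power_one_right to_fract_eq_0_iff monom_eq_0_iff one_neq_zero)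
  \<comment> \<open>The exponent is \<open>2 * M + 1\<close>, so the tail starts at the first factor
    left unpaired.\<close>
  have "qh powi (2 * m + s + 1) = (qh :: 'a poly fract) ^ (2 * M + 1)"
    by (simp only: power_int_of_nat[symmetric]) (simp add: m s algebra_simps)
  then have arg: "- of_int \<epsilon> * fls_const (qh powi (2 * m + s + 1)) = fls_const (- e * (qh * ((qh :: 'a poly fract)\<^sup>2) ^ M))"
    by (simp add: e_def fls_of_int power_mult)
  have "(\<Sum>k = -n..m. e powi (k + d) * of_int (Legendre (k + d) 3)
            * qh powi (k\<^sup>2 + s * k) * qbinom q (n + m) (n + k)) * qpoch (- e * qh) q M
      = qpoch (- e * qh ^ 3) (q ^ 3) M
         * Lz (fls_const (qh powi (- ((s div 2)\<^sup>2))) * (of_int \<epsilon> * fls_X) powi (d - s div 2)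
               * qpoch (- of_int \<epsilon> * fls_const (qh powi (2 * m + s + 1)) / fls_X) (fls_const q) r)"
    using Legendre_qbinom_sum[OF qh_power_neq_1 qh0 ee r, of d]
    unfolding arg s2 by (simp add: q m n s e_def fls_of_int)
  then show ?thesis
    using qpoch_qh_nonzero[OF ee, of M]
    unfolding e_def[symmetric] M_def[symmetric] r_def[symmetric] q
    by (simp add: field_simps)
qed

end
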